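(* Let $a$ and $\lambda$ be complex numbers and let $n$ be a nonnegative integer, such that all terms below are well defined (for $0\le k\le n$ no Gamma function in a numerator is evaluated at a pole, and the denominator on the right-hand side is nonzero). Then $$\sum_{k=0}^{n}\frac{\Gamma(1+k)\,\Gamma(\tfrac32+k)\,\Gamma(\lambda-a+\lambda k)\,\Gamma(\tfrac12+\lambda-a+(1+\lambda)k)\,\Gamma(1+2a+n+(1+2\lambda)k)}{\Gamma(1+n-k)\,\Gamma(2+n+k)\,\Gamma(\tfrac12+k)\,\Gamma(1+a+\lambda k)\,\Gamma(\tfrac32+a+(1+\lambda)k)\,\Gamma(1+2\lambda-2a-n+(1+2\lambda)k)}\,\frac{(-1)^k}{k!}$$ $$=\frac{(-1)^n\,4^{2a-\lambda}\,(1+2a-\lambda)_n}{(\lambda-a+\lambda n)(1+2a+2\lambda n+2n)\,(1)_n}.$$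
   Context: $(x)_0=1$ and $(x)_n=x(x+1)\cdots(x+n-1)$ for $n\ge 1$ is the shifted factorial. $\Gamma$ is the gamma function (meromorphically continued), with $1/\Gamma$ entire, so $1/\Gamma$ is $0$ at the poles of $\Gamma$. For complex $s$, $4^s=e^{s\log 4}$. The left-hand side is the value at $z=-1$ of a terminating Fox-Wright function ${}_5\Psi_6$, where in general ${}_p\Psi_q[z]=\sum_{k\ge0}\frac{\prod_{i=1}^p\Gamma(\alpha_i+A_ik)}{\prod_{j=1}^q\Gamma(\beta_j+B_jk)}\frac{z^k}{k!}$; the factor $1/\Gamma(1+n-k)$ makes the series terminate at $k=n$. *)

theory Defs
  imports "HOL-Analysis.Analysis"
begin

end

theory Submission
  imports Defs
begin

text \<open>
  Write $x_k = 1 + 2a + (1 + 2\lambda)k$ and $y_k = 1 + 2a - (1 + 2\lambda)(k+1)$. By Legendre's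
  duplication formula the Gamma factors of the $k$-th summand collapse to
  $\prod_{i<n} (x_k + i)(y_k + i)$ times a factor independent of $n$, and by Whipple's theorem that
  factor is a terminating ${}_3F_2(-k, k+1, 1+2a-\lambda; x_k+1, y_k+1; 1)$. Each
  $(x_k + i)(y_k + i)$ and each $(-k)_j (k+1)_j$ is a polynomial in $t = k(k+1)$, so after
  exchanging the two sums the sum over $k$ is an $n$-th divided difference at the nodes $t$ of
  a polynomial of degree $n - 1$ for every $j < n$; only $j = n$ survives. This argument needs
  $x_k, y_k$ to be nonintegral, and the remaining $a$ are reached by continuity.
\<close>

section \<open>Whipple's terminating 3F2 sum\<close>

text \<open>
  Gosper's antidifference behind the contiguous relation
  $S_n(e, f) = \rho\, S_{n-1}(e+1, f-1)$ for Whipple's sum; it vanishes at $p = n$.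
\<close>

lemma whipple_telescope:
  fixes c e f :: "'a :: field_char_0" and m :: nat
  assumes sum: "e + f = 1 + 2 * c" and e: "e \<notin> \<int>" and f: "f \<notin> \<int>"
  defines "n \<equiv> of_nat (Suc m) :: 'a"
  defines "\<rho> \<equiv> (e - n) * (f - 1) / (e * (f + n - 1))"
  shows "(\<Sum>k\<le>p. pochhammer (- n) k * pochhammer (n + 1) k * pochhammer c k
              / (fact k * pochhammer e k * pochhammer f k)
            - \<rho> * (pochhammer (1 - n) k * pochhammer n k * pochhammer c k
              / (fact k * pochhammer (e + 1) k * pochhammer (f - 1) k)))
        = 2 * n * pochhammer (1 - n) p * pochhammer (n + 1) p * pochhammer c (Suc p)
              / (fact p * pochhammer e (Suc p) * pochhammer f p * (f + n - 1))"
proof (induction p)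
  have ne: "x + of_int i \<noteq> 0" if "x \<notin> \<int>" for x :: 'a and i
    using that by (metis Ints_minus Ints_of_int add_eq_0_iff2)
  have e0: "e \<noteq> 0" and f1: "f - 1 \<noteq> 0" and fn: "f + n - 1 \<noteq> 0"
    using ne[OF e, of 0] ne[OF f, of "-1"] ne[OF f, of "int m"] by (auto simp: n_def)
  {
    case 0
    have "e * (f + n - 1) - (e - n) * (f - 1) = 2 * n * c"
      using sum by algebra
    moreover have "1 - \<rho> = (e * (f + n - 1) - (e - n) * (f - 1)) / (e * (f + n - 1))"
      using e0 fn by (simp add: \<rho>_def diff_divide_distrib)
    ultimately show ?case by (simp add: mult.commute)
  next
    case (Suc p)
    have ep: "pochhammer e k \<noteq> 0" and fp: "pochhammer f k \<noteq> 0" for k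
      using e f by (auto simp: pochhammer_eq_0_iff)
    define k where "k = (of_nat p :: 'a)"
    have k1: "k + 1 \<noteq> 0"
      unfolding k_def by (metis of_nat_Suc add.commute of_nat_neq_0)
    have ek: "e + k \<noteq> 0" "e + k + 1 \<noteq> 0" and fk: "f + k \<noteq> 0"
      using ne[OF e, of "int p"] ne[OF e, of "int p + 1"] ne[OF f, of "int p"]
      by (auto simp: k_def add_ac)
    have nn: "n \<noteq> 0" by (simp add: n_def del: of_nat_Suc)
    define X where "X = pochhammer (1 - n) p"
    define Y where "Y = pochhammer (n + 1) p"
    define C where "C = pochhammer c (Suc p)"
    define E where "E = pochhammer e (Suc p)"
    define F where "F = pochhammer f p"
    have EF: "E \<noteq> 0" "F \<noteq> 0" using ep fp by (auto simp: E_def F_def)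
    have "pochhammer (e + 1) (Suc p) = pochhammer e (Suc (Suc p)) / e"
      using e0 pochhammer_rec[of e "Suc p"] by simp
    then have r: "pochhammer (- n) (Suc p) = - n * X" "pochhammer (1 - n) (Suc p) = X * (1 - n + k)"
      "pochhammer (n + 1) (Suc p) = Y * (n + 1 + k)" "pochhammer n (Suc p) = n * Y"
      "pochhammer c (Suc (Suc p)) = C * (c + k + 1)"
      "pochhammer e (Suc (Suc p)) = E * (e + k + 1)"
      "pochhammer (e + 1) (Suc p) = E * (e + k + 1) / e"
      "pochhammer f (Suc p) = F * (f + k)" "pochhammer (f - 1) (Suc p) = (f - 1) * F"
      "fact (Suc p) = (k + 1) * fact p"
      using pochhammer_rec[of "- n" p] pochhammer_rec[of n p] pochhammer_rec[of "f - 1" p]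
      by (simp_all add: X_def Y_def C_def E_def F_def k_def pochhammer_Suc add_ac)
    \<comment> \<open>\<open>K\<close> collects the common part of three terms: the antidifference
      at \<open>p\<close> and the two parts of the new summand. Only a polynomial factor of each
      remains, so the step reduces to \<open>key\<close>.\<close>
    define K where "K = n * X * Y * C / ((k + 1) * fact p * E * F * (f + k) * (e + k + 1) * (f + n - 1))"
    \<comment> \<open>This is where \<open>e + f = 1 + 2 * c\<close> enters the induction
      step.\<close>
    have key: "2 * (k + 1) * (e + k + 1) * (f + k)
         - (n + k + 1) * (e + k + 1) * (f + n - 1) - (e - n) * (1 - n + k) * (f + k)
       = 2 * (1 - n + k) * (n + 1 + k) * (c + k + 1)"
      using sum by algebra
    have "2 * n * X * Y * C / (fact p * E * F * (f + n - 1)) + (- n * X * (Y * (n + 1 + k)) * C / ((k + 1) * fact p * E * (F * (f + k)))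
       - \<rho> * (X * (1 - n + k) * (n * Y) * C / ((k + 1) * fact p * (E * (e + k + 1) / e) * ((f - 1) * F))))
      = K * (2 * (k + 1) * (e + k + 1) * (f + k)
         - (n + k + 1) * (e + k + 1) * (f + n - 1) - (e - n) * (1 - n + k) * (f + k))"
      proof -
      have "2 * n * X * Y * C / (fact p * E * F * (f + n - 1)) = K * (2 * (k + 1) * (e + k + 1) * (f + k))"
      proof -
        have "s / (u * r * v * w * t) * (2 * u * w * v) = 2 * s / (r * t)"
          if "u \<noteq> 0" "v \<noteq> 0" "w \<noteq> 0" for r s t u v w :: 'a
          using that by simp
        from this[of "k + 1" "f + k" "e + k + 1" "n * X * Y * C" "fact p * E * F" "f + n - 1", OF k1 fk ek(2)]
        show ?thesis by (simp only: K_def mult.assoc)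
      qed
      moreover have "- n * X * (Y * (n + 1 + k)) * C / ((k + 1) * fact p * E * (F * (f + k)))
          = - (K * ((n + k + 1) * (e + k + 1) * (f + n - 1)))"
        using EF k1 ek fk fn by (simp add: K_def divide_simps) (simp add: algebra_simps)?
      moreover have "\<rho> * (X * (1 - n + k) * (n * Y) * C / ((k + 1) * fact p * (E * (e + k + 1) / e) * ((f - 1) * F)))
          = K * ((e - n) * (1 - n + k) * (f + k))"
        using EF k1 ek fk fn e0 f1 by (simp add: K_def \<rho>_def mult_ac)
      ultimately show ?thesis
        by (simp only: right_diff_distrib[of K] add_diff_eq add_uminus_conv_diff)
    qed
    also have "\<dots> = 2 * n * (X * (1 - n + k)) * (Y * (n + 1 + k)) * (C * (c + k + 1))
         / ((k + 1) * fact p * (E * (e + k + 1)) * (F * (f + k)) * (f + n - 1))"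
      unfolding key K_def by (simp only: times_divide_eq_left times_divide_eq_right mult_ac)
    finally show ?case
      unfolding sum.atMost_Suc Suc.IH r X_def[symmetric] Y_def[symmetric] C_def[symmetric]
        E_def[symmetric] F_def[symmetric] .
  }
qed

text \<open>Moving (e, f) to (e+1, f-1) keeps e + f, so the contiguous relation
  \<open>S_n(e, f) = \<rho> * S_{n-1}(e+1, f-1)\<close> drives an induction on \<open>n\<close>. The
  right-hand side is Whipple's Gamma quotient as a finite product whose factors advance by
  2.\<close>

theorem whipple_terminating:
  fixes c e f :: "'a :: field_char_0"
  assumes "e + f = 1 + 2 * c" "e \<notin> \<int>" "f \<notin> \<int>"
  shows "(\<Sum>k\<le>n. pochhammer (- of_nat n) k * pochhammer (of_nat n + 1) k * pochhammer c k
              / (fact k * pochhammer e k * pochhammer f k))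
        = (\<Prod>i<n. (e - of_nat n + 2 * of_nat i) * (f - of_nat n + 2 * of_nat i))
            / (pochhammer e n * pochhammer f n)"
  using assms
proof (induction n arbitrary: e f)
  case 0
  then show ?case by simp
next
  case (Suc m)
  define n where "n = (of_nat (Suc m) :: 'a)"
  have n: "n = of_nat m + 1" by (simp add: n_def)
  define \<rho> where "\<rho> = (e - n) * (f - 1) / (e * (f + n - 1))"
  have e1: "e + 1 \<notin> \<int>" and f1: "f - 1 \<notin> \<int>"
    using Suc.prems by simp_all
  have nz: "pochhammer x k \<noteq> 0" if "x \<notin> \<int>" for x :: 'a and k
    using that by (auto simp: pochhammer_eq_0_iff)
  define T where "T = (\<lambda>k. pochhammer (- n) k * pochhammer (n + 1) k * pochhammer c k
              / (fact k * pochhammer e k * pochhammer f k))"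
  define U where "U = (\<lambda>k. pochhammer (1 - n) k * pochhammer n k * pochhammer c k
              / (fact k * pochhammer (e + 1) k * pochhammer (f - 1) k))"
  \<comment> \<open>As 1 - n = -m, this factor of the antidifference vanishes at p = m + 1; it also
    removes the last term of the sum of \<open>U\<close> below.\<close>
  have "pochhammer (1 - n) (Suc m) = 0"
    using pochhammer_of_nat_eq_0_lemma[of m "Suc m", where 'a = 'a] by (simp add: n)
  then have "(\<Sum>k\<le>Suc m. T k - \<rho> * U k) = 0"
    unfolding T_def U_def \<rho>_def n_def
    by (subst whipple_telescope[OF Suc.prems]) simp
  then have "(\<Sum>k\<le>Suc m. T k) = \<rho> * (\<Sum>k\<le>Suc m. U k)"
    by (simp only: sum_subtractf sum_distrib_left right_minus_eq)
  also have "(\<Sum>k\<le>Suc m. U k) = (\<Sum>k\<le>m. U k)"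
    using pochhammer_of_nat_eq_0_lemma[of m "Suc m", where 'a = 'a] by (simp add: U_def n)
  also have "\<dots> = (\<Prod>i<m. (e + 1 - of_nat m + 2 * of_nat i) * (f - 1 - of_nat m + 2 * of_nat i))
            / (pochhammer (e + 1) m * pochhammer (f - 1) m)"
    using Suc.IH[OF _ e1 f1] Suc.prems(1) by (simp add: U_def n add_ac)
  also have "\<rho> * \<dots> = (\<Prod>i<Suc m. (e - n + 2 * of_nat i) * (f - n + 2 * of_nat i))
            / (pochhammer e (Suc m) * pochhammer f (Suc m))"
    proof -
    have fm: "f + of_nat m \<noteq> 0" "f - 1 + of_nat m \<noteq> 0" "f - 1 \<noteq> 0" "e \<noteq> 0"
      using nz[OF Suc.prems(3), of "Suc m"] nz[OF f1, of "Suc m"] nz[OF f1, of 1] nz[OF Suc.prems(2), of 1]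
      by (simp_all add: pochhammer_Suc)
    have "pochhammer (e + 1) m = pochhammer e (Suc m) / e"
      using fm by (simp add: pochhammer_rec)
    moreover have "pochhammer (f - 1) m
        = (f - 1) * pochhammer f (Suc m) / ((f - 1 + of_nat m) * (f + of_nat m))"
      using fm pochhammer_rec[of "f - 1" "Suc m"]
      by (simp add: pochhammer_Suc[of "f - 1"] eq_divide_eq mult.assoc)
    \<comment> \<open>The shift to (e+1, f-1) drops the first factor, e - n, from the e-product and
      the last factor, f - 1 + m, from the f-product.\<close>
    moreover have "(\<Prod>i<Suc m. e - n + 2 * of_nat i) = (e - n) * (\<Prod>i<m. e + 1 - of_nat m + 2 * of_nat i)"
      by (simp only: prod.lessThan_Suc_shift) (simp add: n algebra_simps)
    moreover have "(\<Prod>i<Suc m. f - n + 2 * of_nat i) = (\<Prod>i<m. f - 1 - of_nat m + 2 * of_nat i) * (f - 1 + of_nat m)"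
      by (simp add: n algebra_simps)
    moreover have "f + n - 1 = f + of_nat m" by (simp add: n)
    ultimately show ?thesis
      using fm nz[OF Suc.prems(2), of "Suc m"] nz[OF Suc.prems(3), of "Suc m"]
      by (simp only: prod.distrib \<rho>_def) simp
  qed
  finally show ?case by (simp add: T_def n_def)
qed

section \<open>Vanishing divided differences at the nodes k(k+1)\<close>

text \<open>With t_k = k(k+1) one has t_k - t_j = (k-j)(k+j+1), so up to the sign (-1)^n the weights
  are the reciprocals of the products of t_k - t_j over j other than k. The sum is thus an n-th
  divided difference of a polynomial in t of degree below n. The slopes \<open>g i\<close> may be 0,
  as happens in the application when 1 + 2l = 0.\<close>

lemma alternating_quadratic_sum_eq_0:
  fixes b g :: "'b \<Rightarrow> 'a :: field_char_0"
  assumes "finite I" "card I < n"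
  shows "(\<Sum>k\<le>n. (-1) ^ k * (2 * of_nat k + 1) / (fact (n - k) * fact (n + k + 1))
            * (\<Prod>i\<in>I. b i + g i * (of_nat k * (of_nat k + 1)))) = 0"
  using assms
proof (induction I arbitrary: n rule: finite_induct)
  case empty
  then have n: "n > 0" by simp
  \<comment> \<open>The partial sums have a closed form; at p = n it is exactly the negative of n
    times the remaining term k = n.\<close>
  have *: "of_nat n * (\<Sum>k<p. (-1) ^ k * (2 * of_nat k + 1) / (fact (n - k) * fact (n + k + 1)) :: 'a)
      = - ((-1) ^ p * of_nat p / (fact (n - p) * fact (n + p)))" if "p \<le> n" for p
    using that
  proof (induction p)
    case 0
    then show ?case by simp
  next
    case (Suc p)
    define q where "q = n - Suc p"
    have q: "n = q + p + 1" "n - p = Suc q" using Suc.prems by (auto simp: q_def)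
    show ?case
    proof -
      define r s where "r = (of_nat q :: 'a)" and "s = (of_nat p :: 'a)"
      define A B where "A = (fact q :: 'a)" and "B = (fact (n + p) :: 'a)"
      have AB: "A \<noteq> 0" "B \<noteq> 0" by (simp_all add: A_def B_def)
      have rs: "r + 1 \<noteq> 0" "2 * s + r + 2 \<noteq> 0"
        unfolding r_def s_def
        using of_nat_neq_0[of q, where 'a = 'a] of_nat_neq_0[of "2 * p + q + 1", where 'a = 'a]
        by (simp_all add: algebra_simps)
      have f: "fact (n - p) = (r + 1) * A" "fact (n + p + 1) = (2 * s + r + 2) * B"
        "fact (n - Suc p) = A" "fact (n + Suc p) = (2 * s + r + 2) * B" "fact (n + p) = B"
        "of_nat n = r + s + 1" "of_nat (Suc p) = s + 1"
        using q by (simp_all add: r_def s_def A_def B_def q_def[symmetric] algebra_simps)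
      have "of_nat n * (\<Sum>k<Suc p. (-1) ^ k * (2 * of_nat k + 1) / (fact (n - k) * fact (n + k + 1)) :: 'a)
        = - ((-1) ^ p * s / ((r + 1) * A * B))
          + (r + s + 1) * ((-1) ^ p * (2 * s + 1) / ((r + 1) * A * ((2 * s + r + 2) * B)))"
        using Suc.IH Suc.prems by (simp only: sum.lessThan_Suc distrib_left f Suc_leD s_def)
      also have "\<dots> = (-1) ^ p * ((r + s + 1) * (2 * s + 1) - s * (2 * s + r + 2)) / ((r + 1) * A * ((2 * s + r + 2) * B))"
        using AB rs by (simp add: divide_simps) (simp add: algebra_simps)
      also have "(r + s + 1) * (2 * s + 1) - s * (2 * s + r + 2) = (r + 1) * (s + 1)"
        by algebra
      also have "(-1) ^ p * ((r + 1) * (s + 1)) / ((r + 1) * A * ((2 * s + r + 2) * B))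
        = - ((-1) ^ Suc p * (s + 1) / (A * ((2 * s + r + 2) * B)))"
        using AB rs by simp
      finally show ?case by (simp only: f)
    qed
  qed
  show ?case 
  proof -
    have "fact (n + n + 1) = ((2 * of_nat n + 1) * fact (n + n) :: 'a)"
      by (simp add: algebra_simps)
    moreover have "2 * of_nat n + 1 \<noteq> (0 :: 'a)"
      using of_nat_neq_0[of "2 * n", where 'a = 'a] by (simp add: algebra_simps)
    ultimately have "(-1) ^ n * (2 * of_nat n + 1) / (fact (n - n) * fact (n + n + 1))
        = ((-1) ^ n / (fact (n - n) * fact (n + n)) :: 'a)"
      by (simp only:) simp
    then have "of_nat n * (\<Sum>k\<le>n. (-1) ^ k * (2 * of_nat k + 1) / (fact (n - k) * fact (n + k + 1)) :: 'a) = 0"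
      using *[of n] by (simp only: lessThan_Suc_atMost[symmetric] sum.lessThan_Suc distrib_left) simp
    then show ?thesis using n by simp
  qed
next
  case (insert x I)
  have "Suc (card I) < n" using insert.prems insert.hyps by simp
  then obtain m where n: "n = Suc m" and m: "card I < m"
    by (cases n) auto
  define w where "w = (\<lambda>n k. (-1) ^ k * (2 * of_nat k + 1) / (fact (n - k) * fact (n + k + 1)) :: 'a)"
  define P where "P = (\<lambda>k. \<Prod>i\<in>I. b i + g i * (of_nat k * (of_nat k + 1)))"
  have IH: "(\<Sum>k\<le>l. w l k * P k) = 0" if "card I < l" for l
    unfolding w_def P_def by (rule insert.IH[OF that])
  define N where "N = (of_nat n * (of_nat n + 1) :: 'a)"
  \<comment> \<open>N - k(k+1) = (n-k)(n+k+1) cancels the top factor of each factorial and so lowers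
    n by one.\<close>
  have w: "w n k * (N - of_nat k * (of_nat k + 1)) = w m k" if k: "k \<le> m" for k
  proof -
    obtain q where q: "m = k + q" using le_Suc_ex[OF k] by auto
    have "N - of_nat k * (of_nat k + 1) = of_nat (Suc q) * of_nat (n + k + 1)"
      by (simp add: N_def n q algebra_simps)
    moreover have "fact (n - k) = (of_nat (Suc q) * fact (m - k) :: 'a)"
      "fact (n + k + 1) = (of_nat (n + k + 1) * fact (m + k + 1) :: 'a)"
      by (simp_all add: n q)
    ultimately show ?thesis
      by (simp add: w_def del: of_nat_Suc of_nat_add)
  qed
  \<comment> \<open>The new linear factor b + g t is split as (b + g N) - g (N - t): the first part
    keeps n, the second lowers it to m, and the induction hypothesis covers both.\<close>
  have "w n k * (\<Prod>i\<in>insert x I. b i + g i * (of_nat k * (of_nat k + 1)))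
      = (b x + g x * N) * (w n k * P k) - g x * (w n k * (N - of_nat k * (of_nat k + 1)) * P k)" for k
    using insert.hyps by (simp add: P_def algebra_simps)
  then have "(\<Sum>k\<le>n. w n k * (\<Prod>i\<in>insert x I. b i + g i * (of_nat k * (of_nat k + 1))))
    = (b x + g x * N) * (\<Sum>k\<le>n. w n k * P k)
      - g x * (\<Sum>k\<le>n. w n k * (N - of_nat k * (of_nat k + 1)) * P k)"
    by (simp only: sum_subtractf sum_distrib_left)
  \<comment> \<open>The term k = n drops out because N - t vanishes there.\<close>
  also have "(\<Sum>k\<le>n. w n k * (N - of_nat k * (of_nat k + 1)) * P k) = (\<Sum>k\<le>m. w m k * P k)"
    using w by (simp add: n N_def)
  finally have "(\<Sum>k\<le>n. w n k * (\<Prod>i\<in>insert x I. b i + g i * (of_nat k * (of_nat k + 1)))) = 0"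
    by (simp only: IH[OF m] IH[OF less_trans[OF m lessI], folded n] mult_zero_right diff_self)
  then show ?case by (simp only: w_def)
qed

section \<open>Pochhammer and Gamma preliminaries\<close>

lemma pochhammer_mult_pochhammer:
  "pochhammer x n * pochhammer y n = (\<Prod>i<n. (x + of_nat i) * (y + of_nat i))"
  by (simp add: pochhammer_prod prod.distrib atLeast0LessThan)

text \<open>Pairing the i-th factors, (-k+i)(k+1+i) = i(i+1) - k(k+1), exhibits the product as a
  polynomial of degree j in t = k(k+1).\<close>

lemma pochhammer_neg_mult:
  "pochhammer (- of_nat k) j * pochhammer (of_nat k + 1) j
     = (\<Prod>i<j. of_nat i * (of_nat i + 1) - of_nat k * (of_nat k + 1) :: 'a :: comm_ring_1)"
  unfolding pochhammer_mult_pochhammer by (intro prod.cong) (auto simp: algebra_simps)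

lemma Gamma_pochhammer:
  fixes z :: "'a :: Gamma"
  assumes "z \<notin> \<int>\<^sub>\<le>\<^sub>0"
  shows "Gamma (z + of_nat n) = pochhammer z n * Gamma z"
  using assms by (simp add: pochhammer_Gamma Gamma_eq_zero_iff)

text \<open>Supplies the two side conditions of Legendre's duplication formula.\<close>

lemma not_nonpos_Ints_half:
  fixes z :: complex
  assumes "2 * z \<notin> \<int>"
  shows "z \<notin> \<int>\<^sub>\<le>\<^sub>0" "z + 1/2 \<notin> \<int>\<^sub>\<le>\<^sub>0"
proof -
  show "z \<notin> \<int>\<^sub>\<le>\<^sub>0"
    using assms by (metis Ints_mult Ints_numeral nonpos_Ints_Int)
  have "2 * z = 2 * (z + 1/2) - 1" by simp
  then show "z + 1/2 \<notin> \<int>\<^sub>\<le>\<^sub>0"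
    using assms by (metis Ints_mult Ints_numeral Ints_diff Ints_1 nonpos_Ints_Int)
qed

text \<open>Matches the exponential in Legendre's formula; later it also makes continuity of the
  right-hand side evident.\<close>

lemma four_powr: "4 powr s = exp (2 * s * of_real (ln 2))" for s :: complex
proof -
  have "ln (4 :: real) = 2 * ln 2"
    using ln_realpow[of 2 2] by simp
  then have "Ln 4 = 2 * complex_of_real (ln 2)"
    using Ln_of_real[of 4] by simp
  then show ?thesis by (simp add: powr_def mult_ac)
qed

section \<open>Collapse of the Gamma factors\<close>

text \<open>The half-shifted pairs are duplication pairs up to a shift by k. Duplication leaves
  Gamma at 2A in the numerator and at x + k + 1 in the denominator, at integer distance from the two
  remaining arguments. The leftover Pochhammer symbols are the numerator of Whipple's sum with e = x
  + 1, f = y + 1.\<close>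

lemma gamma_factor_eq_whipple_sum:
  fixes a l :: complex and n k :: nat
  defines "x \<equiv> 1 + 2 * a + (1 + 2 * l) * of_nat k" and "y \<equiv> 1 + 2 * a - (1 + 2 * l) * (of_nat k + 1)"
  assumes x: "x \<notin> \<int>" and y: "y \<notin> \<int>"
  shows "Gamma (l - a + l * of_nat k) * Gamma (1/2 + l - a + (1 + l) * of_nat k)
      * Gamma (1 + 2 * a + of_nat n + (1 + 2 * l) * of_nat k)
      * (rGamma (1 + a + l * of_nat k) * rGamma (3/2 + a + (1 + l) * of_nat k)
      * rGamma (1 + 2 * l - 2 * a - of_nat n + (1 + 2 * l) * of_nat k))
    = (-1) ^ Suc n * 4 * 4 powr (2 * a - l) * (\<Prod>i<n. (x + of_nat i) * (y + of_nat i)) / (x * y)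
      * (\<Sum>j\<le>k. pochhammer (- of_nat k) j * pochhammer (of_nat k + 1) j * pochhammer (1 + 2 * a - l) j
           / (fact j * pochhammer (x + 1) j * pochhammer (y + 1) j))"
proof -
  define A where "A = l - a + l * of_nat k"
  define B where "B = 1 + a + l * of_nat k"
  define L where "L = complex_of_real (ln 2)"
  have nonpos: "z \<notin> \<int>\<^sub>\<le>\<^sub>0" if "z \<notin> \<int>" for z :: complex
    using that nonpos_Ints_Int by blast
  have poch: "pochhammer z j \<noteq> 0" if "z \<notin> \<int>" for z :: complex and j
    using that by (auto simp: pochhammer_eq_0_iff)
  have xy: "x + 1 \<notin> \<int>" "y + 1 \<notin> \<int>" "x \<noteq> 0" "y \<noteq> 0" using x y by auto
  have A2: "2 * A = - y - of_nat k"
    by (simp add: A_def y_def algebra_simps)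
  then have "2 * A \<notin> \<int>"
    using y by (metis Ints_add Ints_of_nat Ints_minus diff_add_cancel minus_minus)
  note A = this not_nonpos_Ints_half[OF this]
  have B2: "2 * (B + of_nat k) = x + of_nat (Suc k)"
    by (simp add: B_def x_def algebra_simps)
  then have "2 * (B + of_nat k) \<notin> \<int>"
    using x by (metis Ints_diff Ints_of_nat add_diff_cancel_right')
  note B = this not_nonpos_Ints_half[OF this]
  have neg: "pochhammer (- z - of_nat j + 1) j = (-1) ^ j * pochhammer z j" for z :: complex and j
    using pochhammer_minus'[of "- z" j] by simp
  \<comment> \<open>The arguments A and A + 1/2 + k become a duplication pair once (A + 1/2)_k is
    split off; in \<open>G2\<close>, B is raised to B + k instead.\<close>
  have G1: "Gamma A * Gamma (A + 1/2 + of_nat k)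
      = pochhammer (A + 1/2) k * (exp ((1 - 2 * A) * L) * of_real (sqrt pi) * Gamma (2 * A))"
    using Gamma_legendre_duplication[OF A(2,3)]
    by (simp add: Gamma_pochhammer[OF A(3)] L_def)
  have "inverse (Gamma (B + of_nat k) * Gamma (B + of_nat k + 1/2))
      = inverse (exp ((1 - 2 * (B + of_nat k)) * L) * of_real (sqrt pi) * Gamma (2 * (B + of_nat k)))"
    by (simp only: Gamma_legendre_duplication[OF B(2,3)] L_def)
  then have G2: "rGamma B * rGamma (B + of_nat k + 1/2)
      = pochhammer B k / (exp ((1 - 2 * (B + of_nat k)) * L) * of_real (sqrt pi)) * rGamma (x + of_nat (Suc k))"
    unfolding B2 by (subst pochhammer_rGamma[of B k]) (simp add: rGamma_inverse_Gamma field_simps)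
  have G3: "Gamma (x + of_nat n) * rGamma (x + of_nat (Suc k)) = pochhammer x n / pochhammer x (Suc k)"
    using nonpos[OF x] poch[OF x, of "Suc k"]
    by (simp add: Gamma_pochhammer rGamma_inverse_Gamma Gamma_eq_zero_iff field_simps del: of_nat_Suc)
  have M: "1 - y = 2 * A + of_nat (Suc k)" by (simp add: A2)
  \<comment> \<open>Both 1 - y - n and 2A lie an integer below 1 - y, by n and k + 1; reversing the
    two Pochhammer symbols gives the signs and the symbols in y.\<close>
  have G4: "rGamma (1 - y - of_nat n) * Gamma (2 * A) = (-1) ^ n * pochhammer y n / ((-1) ^ Suc k * pochhammer y (Suc k))"
  proof -
    have "rGamma (1 - y - of_nat n) = (-1) ^ n * pochhammer y n * rGamma (1 - y)"
      using pochhammer_rGamma[of "1 - y - of_nat n" n] neg[of y n] by (simp add: algebra_simps)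
    moreover have "2 * A = - y - of_nat (Suc k) + 1" by (simp add: A2)
    then have "pochhammer (2 * A) (Suc k) = (-1) ^ Suc k * pochhammer y (Suc k)"
      by (simp only: neg)
    then have "rGamma (2 * A) = (-1) ^ Suc k * pochhammer y (Suc k) * rGamma (1 - y)"
      using pochhammer_rGamma[of "2 * A" "Suc k"] by (simp only: M)
    moreover have "rGamma (2 * A) * Gamma (2 * A) = 1"
      using nonpos[OF A(1)] by (simp add: rGamma_inverse_Gamma Gamma_eq_zero_iff)
    ultimately have "rGamma (1 - y) * Gamma (2 * A) = 1 / ((-1) ^ Suc k * pochhammer y (Suc k))"
      using poch[OF y, of "Suc k"] by (subst eq_divide_eq) (simp only: mult_ac, simp)
    then show ?thesis
      by (simp only: \<open>rGamma (1 - y - of_nat n) = _\<close> mult.assoc) simp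
  qed
  \<comment> \<open>The exponents differ by 2(1 + 2a - l + k) log 2. The factor 4^k and the sign
    (-1)^k from \<open>G4\<close> later form the (-4)^k of \<open>W\<close>.\<close>
  have E: "exp ((1 - 2 * A) * L) / exp ((1 - 2 * (B + of_nat k)) * L) = 4 * 4 powr (2 * a - l) * 4 ^ k"
  proof -
    have "exp (2 * L) = 4"
      using four_powr[of 1] by (simp add: L_def)
    then have "4 ^ k = exp (of_nat k * (2 * L))"
      by (simp add: exp_of_nat_mult)
    then have "4 * 4 powr (2 * a - l) * 4 ^ k = exp (2 * L) * exp (2 * (2 * a - l) * L) * exp (of_nat k * (2 * L))"
      using \<open>exp (2 * L) = 4\<close> by (simp add: four_powr L_def)
    also have "\<dots> = exp ((1 - 2 * A) * L - (1 - 2 * (B + of_nat k)) * L)"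
      unfolding exp_add[symmetric] by (rule arg_cong[of _ _ exp]) (simp add: A_def B_def algebra_simps)
    finally show ?thesis by (simp add: exp_diff)
  qed
  \<comment> \<open>In Whipple's products, x + 1 - k = 2B and y + 1 - k = -2(A + 1/2) - 2k + 2;
    halving the factors gives (B)_k and a reversed (A + 1/2)_k.\<close>
  have W: "(\<Sum>j\<le>k. pochhammer (- of_nat k) j * pochhammer (of_nat k + 1) j * pochhammer (1 + 2 * a - l) j
           / (fact j * pochhammer (x + 1) j * pochhammer (y + 1) j))
      = (-4) ^ k * pochhammer (A + 1/2) k * pochhammer B k / (pochhammer (x + 1) k * pochhammer (y + 1) k)"
  proof -
    have "(\<Prod>i<k. x + 1 - of_nat k + 2 * of_nat i) = (\<Prod>i<k. 2 * (B + of_nat i))"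
      by (intro prod.cong) (auto simp: x_def B_def algebra_simps)
    also have "\<dots> = 2 ^ k * pochhammer B k"
      by (simp add: prod.distrib pochhammer_prod atLeast0LessThan del: distrib_left_numeral)
    finally have 1: "(\<Prod>i<k. x + 1 - of_nat k + 2 * of_nat i) = 2 ^ k * pochhammer B k" .
    have "(\<Prod>i<k. y + 1 - of_nat k + 2 * of_nat i) = (\<Prod>i<k. 2 * ((- (A + 1/2) - of_nat k + 1) + of_nat i))"
      by (intro prod.cong) (auto simp: y_def A_def algebra_simps)
    also have "\<dots> = 2 ^ k * ((-1) ^ k * pochhammer (A + 1/2) k)"
      unfolding neg[symmetric] by (simp add: prod.distrib pochhammer_prod atLeast0LessThan del: distrib_left_numeral)
    finally have 2: "(\<Prod>i<k. y + 1 - of_nat k + 2 * of_nat i) = 2 ^ k * ((-1) ^ k * pochhammer (A + 1/2) k)" .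
    have "(2 :: complex) ^ k * (2 ^ k * (-1) ^ k) = (-4) ^ k"
      by (simp flip: power_mult_distrib)
    then show ?thesis
      using whipple_terminating[of "x + 1" "y + 1" "1 + 2 * a - l" k] xy
      unfolding prod.distrib 1 2 by (simp add: x_def y_def algebra_simps)
  qed
  have px: "pochhammer x (Suc k) = x * pochhammer (x + 1) k" "pochhammer y (Suc k) = y * pochhammer (y + 1) k"
    by (simp_all add: pochhammer_rec)
  have "Gamma (l - a + l * of_nat k) * Gamma (1/2 + l - a + (1 + l) * of_nat k)
      * Gamma (1 + 2 * a + of_nat n + (1 + 2 * l) * of_nat k)
      * (rGamma (1 + a + l * of_nat k) * rGamma (3/2 + a + (1 + l) * of_nat k)
      * rGamma (1 + 2 * l - 2 * a - of_nat n + (1 + 2 * l) * of_nat k))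
    = (Gamma A * Gamma (A + 1/2 + of_nat k)) * Gamma (x + of_nat n)
      * ((rGamma B * rGamma (B + of_nat k + 1/2)) * rGamma (1 - y - of_nat n))"
    by (simp add: A_def B_def x_def y_def algebra_simps)
  also have "\<dots> = (Gamma (x + of_nat n) * rGamma (x + of_nat (Suc k))) * (rGamma (1 - y - of_nat n) * Gamma (2 * A))
      * (exp ((1 - 2 * A) * L) / exp ((1 - 2 * (B + of_nat k)) * L)) * pochhammer (A + 1/2) k * pochhammer B k"
    unfolding G1 G2 by simp
  also have "\<dots> = (-1) ^ Suc n * 4 * 4 powr (2 * a - l) * (pochhammer x n * pochhammer y n) / (x * y)
      * ((-4) ^ k * pochhammer (A + 1/2) k * pochhammer B k / (pochhammer (x + 1) k * pochhammer (y + 1) k))"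
  proof -
    have "(-4) ^ k = (-1) ^ k * (4 :: complex) ^ k"
      by (simp flip: power_mult_distrib)
    then show ?thesis
      unfolding G3 G4 E px by (cases "even k") (simp_all add: mult_ac)
  qed
  finally show ?thesis
    unfolding W pochhammer_mult_pochhammer[of x n y] .
qed

section \<open>Exchange of the two sums\<close>

lemma divided_difference_sum:
  fixes a l :: complex and n :: nat
  defines "x \<equiv> \<lambda>k. 1 + 2 * a + (1 + 2 * l) * of_nat k"
    and "y \<equiv> \<lambda>k. 1 + 2 * a - (1 + 2 * l) * (of_nat k + 1)"
  assumes x: "\<And>k. k \<le> n \<Longrightarrow> x k \<notin> \<int>" and y: "\<And>k. k \<le> n \<Longrightarrow> y k \<notin> \<int>"
  shows "(\<Sum>k\<le>n. (-1) ^ k * (2 * of_nat k + 1) / (fact (n - k) * fact (n + k + 1))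
        * ((\<Prod>i<n. (x k + of_nat i) * (y k + of_nat i)) / (x k * y k)
           * (\<Sum>j\<le>k. pochhammer (- of_nat k) j * pochhammer (of_nat k + 1) j * c j
                / (pochhammer (x k + 1) j * pochhammer (y k + 1) j))))
     = c n / ((x n + of_nat n) * (y n + of_nat n))"
proof -
  define w where "w = (\<lambda>k. (-1) ^ k * (2 * of_nat k + 1) / (fact (n - k) * fact (n + k + 1)) :: complex)"
  define t where "t = (\<lambda>k. of_nat k * (of_nat k + 1) :: complex)"
  define q where "q = (\<lambda>k i. (x k + of_nat i) * (y k + of_nat i))"
  \<comment> \<open>What remains of the k, j term after cancelling \<open>q k 0\<close>, ...,
    \<open>q k j\<close>. For j = n the denominator runs one factor past the numerator, hence the
    extra \<open>q k n\<close>.\<close>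
  define R where "R = (\<lambda>k j. (\<Prod>i<j. of_nat i * (of_nat i + 1) - t k) * (\<Prod>i\<in>{j<..<n}. q k i) / (if j = n then q k n else 1))"
  have nz: "q k i \<noteq> 0" if "k \<le> n" for k i
    using x[OF that] y[OF that] by (auto simp: q_def add_eq_0_iff2)
  have R: "(\<Prod>i<n. q k i) / (x k * y k)
      * (pochhammer (- of_nat k) j * pochhammer (of_nat k + 1) j * c j
          / (pochhammer (x k + 1) j * pochhammer (y k + 1) j)) = c j * R k j"
    if k: "k \<le> n" and j: "j \<le> n" for k j
  proof -
    have "x k * y k * (pochhammer (x k + 1) j * pochhammer (y k + 1) j)
        = pochhammer (x k) (Suc j) * pochhammer (y k) (Suc j)"
      by (simp add: pochhammer_rec)
    also have "\<dots> = (\<Prod>i<Suc j. q k i)"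
      unfolding pochhammer_mult_pochhammer q_def ..
    finally have 1: "x k * y k * (pochhammer (x k + 1) j * pochhammer (y k + 1) j) = (\<Prod>i<Suc j. q k i)" .
    have "(\<Prod>i<n. q k i) / (\<Prod>i<Suc j. q k i)
        = (\<Prod>i\<in>{j<..<n}. q k i) / (if j = n then q k n else 1)"
    proof (cases "j = n")
      case True
      then show ?thesis using nz[OF k] by simp
    next
      case False
      then have S: "{..<n} = {..<Suc j} \<union> {j<..<n}" using j by auto
      have "(\<Prod>i<n. q k i) = (\<Prod>i<Suc j. q k i) * (\<Prod>i\<in>{j<..<n}. q k i)"
        unfolding S by (rule prod.union_disjoint) auto
      then show ?thesis using nz[OF k] False by simp
    qed
    then have 2: "(\<Prod>i<n. q k i) / (x k * y k * (pochhammer (x k + 1) j * pochhammer (y k + 1) j))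
        = (\<Prod>i\<in>{j<..<n}. q k i) / (if j = n then q k n else 1)"
      by (simp only: 1)
    have "P / u * (N * d / D) = d * (N * (P / (u * D)))" for P N d D u :: complex
      by simp
    then show ?thesis
      by (simp only: 2 R_def t_def pochhammer_neg_mult) simp
  qed
  have zero: "(\<Sum>k\<le>n. w k * R k j) = 0" if j: "j < n" for j
  proof -
    \<comment> \<open>For i > j, with u = 1 + 2a + i and v = 1 + 2l, (u + vk)(u - v(k+1)) = u(u - v)
      - v^2 t. There are j + (n-1-j) = n - 1 linear factors in all.\<close>
    define b where "b = (\<lambda>i. if i < j then of_nat i * (of_nat i + 1)
      else (1 + 2 * a + of_nat i) * (1 + 2 * a + of_nat i - (1 + 2 * l)))"
    define g where "g = (\<lambda>i. if i < j then -1 else - ((1 + 2 * l) ^ 2))"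
    have "R k j = (\<Prod>i\<in>{..<j} \<union> {j<..<n}. b i + g i * t k)" for k
    proof -
      have "(\<Prod>i\<in>{j<..<n}. q k i) = (\<Prod>i\<in>{j<..<n}. b i + g i * t k)"
        by (intro prod.cong) (auto simp: q_def x_def y_def b_def g_def t_def algebra_simps power2_eq_square)
      moreover have "(\<Prod>i<j. of_nat i * (of_nat i + 1) - t k) = (\<Prod>i<j. b i + g i * t k)"
        by (intro prod.cong) (auto simp: b_def g_def)
      ultimately show ?thesis
        using j by (simp add: R_def, subst prod.union_disjoint) auto
    qed
    moreover have "card ({..<j} \<union> {j<..<n}) < n"
      using j by (subst card_Un_disjoint) auto
    ultimately show ?thesis
      using alternating_quadratic_sum_eq_0[of "{..<j} \<union> {j<..<n}" n b g]
      by (simp only: w_def t_def) simp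
  qed
  \<comment> \<open>The factor i = k is zero. This extends the inner sum to all j up to n, so that
    the sums can be exchanged.\<close>
  have R0: "R k j = 0" if "k < j" for k j
    using that by (auto simp: R_def t_def intro!: bexI[of _ k])
  have atMost_n: "(\<Sum>j\<le>n. f j) = (\<Sum>j<n. f j) + f n" for f :: "nat \<Rightarrow> complex"
    by (simp add: lessThan_Suc_atMost[symmetric])
  \<comment> \<open>Only k = n contributes: there (-n)_n (n+1)_n = (-1)^n (2n)!, which
    \<open>w n\<close> = (-1)^n / (2n)! normalizes to 1.\<close>
  have last: "(\<Sum>k\<le>n. w k * R k n) = 1 / q n n"
  proof -
    have "R n n = pochhammer (- of_nat n) n * pochhammer (of_nat n + 1) n / q n n"
      by (simp add: R_def t_def pochhammer_neg_mult)
    also have "\<dots> = (-1) ^ n * fact (n + n) / q n n"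
    proof -
      have "fact n * pochhammer (of_nat n + 1) n = (fact (n + n) :: complex)"
        using pochhammer_product'[of "1 :: complex" n n]
        by (simp add: pochhammer_fact add.commute)
      then show ?thesis by (simp add: pochhammer_same mult.assoc)
    qed
    finally have Rn: "R n n = (-1) ^ n * fact (n + n) / q n n" .
    have "w n * R n n = 1 / q n n"
    proof -
      have "(fact (n + n + 1) :: complex) = (2 * of_nat n + 1) * fact (n + n)"
        by (simp add: algebra_simps)
      moreover have "2 * of_nat n + 1 \<noteq> (0 :: complex)"
        using of_nat_neq_0[of "2 * n", where 'a = complex] by (simp add: add.commute)
      moreover have "(-1) ^ n * (-1) ^ n = (1 :: complex)"
        by (simp flip: power_mult_distrib)
      ultimately show ?thesis
        unfolding w_def Rn by (simp only:) simp
    qed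
    moreover have "(\<Sum>k<n. w k * R k n) = 0"
      using R0 by (intro sum.neutral) auto
    ultimately show ?thesis
      unfolding atMost_n by simp
  qed
  have "(\<Sum>k\<le>n. w k * ((\<Prod>i<n. q k i) / (x k * y k)
           * (\<Sum>j\<le>k. pochhammer (- of_nat k) j * pochhammer (of_nat k + 1) j * c j
                / (pochhammer (x k + 1) j * pochhammer (y k + 1) j))))
      = (\<Sum>k\<le>n. w k * (\<Sum>j\<le>k. c j * R k j))"
  proof (intro sum.cong refl arg_cong2[of _ _ _ _ "(*)"])
    fix k assume "k \<in> {..n}"
    then show "(\<Prod>i<n. q k i) / (x k * y k)
           * (\<Sum>j\<le>k. pochhammer (- of_nat k) j * pochhammer (of_nat k + 1) j * c j
                / (pochhammer (x k + 1) j * pochhammer (y k + 1) j))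
        = (\<Sum>j\<le>k. c j * R k j)"
      unfolding sum_distrib_left by (intro sum.cong refl R) auto
  qed
  also have "\<dots> = (\<Sum>k\<le>n. w k * (\<Sum>j\<le>n. c j * R k j))"
    by (intro sum.cong refl arg_cong2[of _ _ _ _ "(*)"] sum.mono_neutral_left) (auto simp: R0)
  also have "\<dots> = (\<Sum>j\<le>n. c j * (\<Sum>k\<le>n. w k * R k j))"
    by (simp only: sum_distrib_left mult.left_commute, subst sum.swap) (rule refl)
  also have "\<dots> = c n / q n n"
  proof -
    have "(\<Sum>j<n. c j * (\<Sum>k\<le>n. w k * R k j)) = 0"
      using zero by (intro sum.neutral) auto
    then show ?thesis
      by (subst atMost_n) (simp add: last)
  qed
  finally show ?thesis
    by (simp only: w_def q_def)
qed

section \<open>The identity for nonintegral parameters\<close>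

lemma fox_wright_sum_nonintegral:
  fixes a l :: complex and n :: nat
  assumes x: "\<And>k. k \<le> n \<Longrightarrow> 1 + 2 * a + (1 + 2 * l) * of_nat k \<notin> \<int>"
    and y: "\<And>k. k \<le> n \<Longrightarrow> 1 + 2 * a - (1 + 2 * l) * (of_nat k + 1) \<notin> \<int>"
  shows "(\<Sum>k\<le>n.
        (Gamma (1 + of_nat k) * Gamma (3/2 + of_nat k)
          * Gamma (l - a + l * of_nat k)
          * Gamma (1/2 + l - a + (1 + l) * of_nat k)
          * Gamma (1 + 2 * a + of_nat n + (1 + 2 * l) * of_nat k))
        * (rGamma (1 + of_nat n - of_nat k) * rGamma (2 + of_nat n + of_nat k)
          * rGamma (1/2 + of_nat k)
          * rGamma (1 + a + l * of_nat k)
          * rGamma (3/2 + a + (1 + l) * of_nat k)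
          * rGamma (1 + 2 * l - 2 * a - of_nat n + (1 + 2 * l) * of_nat k))
        * ((-1) ^ k / fact k))
     = ((-1) ^ n * 4 powr (2 * a - l) * pochhammer (1 + 2 * a - l) n)
       / ((l - a + l * of_nat n) * (1 + 2 * a + 2 * l * of_nat n + 2 * of_nat n)
            * pochhammer 1 n)" (is "(\<Sum>k\<le>n. ?T k) = ?rhs")
proof -
  define X where "X = (\<lambda>k. 1 + 2 * a + (1 + 2 * l) * of_nat k)"
  define Y where "Y = (\<lambda>k. 1 + 2 * a - (1 + 2 * l) * (of_nat k + 1))"
  define c where "c = (\<lambda>j. pochhammer (1 + 2 * a - l) j / fact j)"
  \<comment> \<open>The 2 is the 4 from the Gamma collapse times the 1/2 in k + 1/2 = (2k + 1)/2,
    the value of the quotient of Gamma at 3/2 + k and 1/2 + k.\<close>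
  define P where "P = (-1) ^ Suc n * 2 * 4 powr (2 * a - l)"
  have T: "?T k = P * ((-1) ^ k * (2 * of_nat k + 1) / (fact (n - k) * fact (n + k + 1))
        * ((\<Prod>i<n. (X k + of_nat i) * (Y k + of_nat i)) / (X k * Y k)
           * (\<Sum>j\<le>k. pochhammer (- of_nat k) j * pochhammer (of_nat k + 1) j * c j
                / (pochhammer (X k + 1) j * pochhammer (Y k + 1) j))))"
    if k: "k \<le> n" for k
  proof -
    have half: "1/2 + of_nat k \<notin> (\<int>\<^sub>\<le>\<^sub>0 :: complex set)"
    proof
      assume "1/2 + of_nat k \<in> (\<int>\<^sub>\<le>\<^sub>0 :: complex set)"
      then obtain m where "1/2 + of_nat k = (- of_nat m :: complex)"
        by (rule nonpos_Ints_cases')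
      then have "Re (1/2 + of_nat k) = Re (- of_nat m)" by simp
      then show False by simp
    qed
    have "Gamma (1 + of_nat k) = (fact k :: complex)"
      by (simp add: Gamma_fact)
    moreover have "Gamma (3/2 + of_nat k) * rGamma (1/2 + of_nat k) = (1/2 + of_nat k :: complex)"
      using Gamma_pochhammer[OF half, of 1] half
      by (simp add: rGamma_inverse_Gamma Gamma_eq_zero_iff add_ac)
    moreover have "rGamma (1 + of_nat n - of_nat k) = (1 / fact (n - k) :: complex)"
      using k Gamma_fact[of "n - k", where 'a = complex] by (simp add: rGamma_inverse_Gamma divide_inverse algebra_simps)
    moreover have "rGamma (2 + of_nat n + of_nat k) = (1 / fact (n + k + 1) :: complex)"
      using Gamma_fact[of "n + k + 1", where 'a = complex] by (simp add: rGamma_inverse_Gamma divide_inverse algebra_simps)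
    moreover have "(f * g1 * b1 * b2 * b3) * (r1 * r2 * g2 * d1 * d2 * d3) * (s / f)
        = (g1 * g2) * (b1 * b2 * b3 * (d1 * d2 * d3)) * r1 * r2 * s"
      if "f \<noteq> 0" for f g1 g2 b1 b2 b3 r1 r2 d1 d2 d3 s :: complex
      using that by simp
    ultimately have "?T k = (1/2 + of_nat k) * (Gamma (l - a + l * of_nat k)
          * Gamma (1/2 + l - a + (1 + l) * of_nat k)
          * Gamma (1 + 2 * a + of_nat n + (1 + 2 * l) * of_nat k)
          * (rGamma (1 + a + l * of_nat k)
          * rGamma (3/2 + a + (1 + l) * of_nat k)
          * rGamma (1 + 2 * l - 2 * a - of_nat n + (1 + 2 * l) * of_nat k)))
          * (1 / fact (n - k)) * (1 / fact (n + k + 1)) * (-1) ^ k"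
      by (simp only: fact_nonzero not_False_eq_True)
    also have "\<dots> = (1/2 + of_nat k) * ((-1) ^ Suc n * 4 * 4 powr (2 * a - l) * (\<Prod>i<n. (X k + of_nat i) * (Y k + of_nat i)) / (X k * Y k)
      * (\<Sum>j\<le>k. pochhammer (- of_nat k) j * pochhammer (of_nat k + 1) j * pochhammer (1 + 2 * a - l) j
           / (fact j * pochhammer (X k + 1) j * pochhammer (Y k + 1) j)))
          * (1 / fact (n - k)) * (1 / fact (n + k + 1)) * (-1) ^ k"
      unfolding X_def Y_def gamma_factor_eq_whipple_sum[OF x[OF k] y[OF k]] ..
    also have "(\<Sum>j\<le>k. pochhammer (- of_nat k) j * pochhammer (of_nat k + 1) j * pochhammer (1 + 2 * a - l) j
           / (fact j * pochhammer (X k + 1) j * pochhammer (Y k + 1) j))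
        = (\<Sum>j\<le>k. pochhammer (- of_nat k) j * pochhammer (of_nat k + 1) j * c j
                / (pochhammer (X k + 1) j * pochhammer (Y k + 1) j))"
      by (simp add: c_def mult.assoc)
    also have "(1/2 + of_nat k) * (m * 4 * p * Q / R * S) * (1 / u) * (1 / v) * s
        = (m * 2 * p) * (s * (2 * of_nat k + 1) / (u * v) * (Q / R * S))" for m p Q R S u v s :: complex
    proof -
      have "z / 2 * (m * 4 * p * Q / R * S) * (1 / u) * (1 / v) * s
          = (m * 2 * p) * (s * z / (u * v) * (Q / R * S))" for z
        by (simp add: mult_ac)
      moreover have "1/2 + of_nat k = (2 * of_nat k + 1) / (2 :: complex)" by simp
      ultimately show ?thesis by (simp only:)
    qed
    finally show ?thesis unfolding P_def .
  qed
  have "(\<Sum>k\<le>n. ?T k) = P * (\<Sum>k\<le>n. ((-1) ^ k * (2 * of_nat k + 1) / (fact (n - k) * fact (n + k + 1))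
        * ((\<Prod>i<n. (X k + of_nat i) * (Y k + of_nat i)) / (X k * Y k)
           * (\<Sum>j\<le>k. pochhammer (- of_nat k) j * pochhammer (of_nat k + 1) j * c j
                / (pochhammer (X k + 1) j * pochhammer (Y k + 1) j)))))"
    unfolding sum_distrib_left[of P] by (intro sum.cong refl T) simp
  also have "(\<Sum>k\<le>n. ((-1) ^ k * (2 * of_nat k + 1) / (fact (n - k) * fact (n + k + 1))
        * ((\<Prod>i<n. (X k + of_nat i) * (Y k + of_nat i)) / (X k * Y k)
           * (\<Sum>j\<le>k. pochhammer (- of_nat k) j * pochhammer (of_nat k + 1) j * c j
                / (pochhammer (X k + 1) j * pochhammer (Y k + 1) j))))) = c n / ((X n + of_nat n) * (Y n + of_nat n))"
    unfolding X_def Y_def by (rule divided_difference_sum[OF x y])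
  \<comment> \<open>The -2 cancels the 2 in \<open>P\<close> and turns (-1)^(n+1) into
    (-1)^n.\<close>
  also have "Y n + of_nat n = - 2 * (l - a + l * of_nat n)"
    by (simp add: Y_def algebra_simps)
  also have "X n + of_nat n = 1 + 2 * a + 2 * l * of_nat n + 2 * of_nat n"
    by (simp add: X_def algebra_simps)
  also have "P * (c n / (u * (- 2 * v))) = (-1) ^ n * 4 powr (2 * a - l) * pochhammer (1 + 2 * a - l) n
       / (v * u * pochhammer 1 n)" for u v
    by (simp add: P_def c_def pochhammer_fact mult_ac)
  finally show ?thesis .
qed

section \<open>Removal of the nonintegrality condition by continuity\<close>

text \<open>Every set of integers is closed, so near \<open>z\<close> the map avoids all integers
  except possibly its value at \<open>z\<close>; being injective, it avoids that value off
  \<open>z\<close>.\<close>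

lemma eventually_not_Ints_at:
  fixes z b d :: complex
  assumes "b \<noteq> 0"
  shows "\<forall>\<^sub>F a in at z. d + b * a \<notin> \<int>"
proof -
  define S where "S = (\<int> :: complex set) - {d + b * z}"
  have "open ((\<lambda>a. d + b * a) -` (- S))"
    by (intro open_vimage open_Compl closed_subset_Ints continuous_intros) (auto simp: S_def)
  then have "\<forall>\<^sub>F a in at z. a \<in> (\<lambda>a. d + b * a) -` (- S)"
    by (rule eventually_at_in_open') (auto simp: S_def)
  moreover have "\<forall>\<^sub>F a in at z. a \<noteq> z"
    by (simp add: eventually_at_filter)
  ultimately show ?thesis
    by eventually_elim (use assms in \<open>auto simp: S_def\<close>)
qed

theorem theorem2:
  fixes a lam :: complex and n :: nat
  assumes numerator_no_poles:
      "\<And>k. k \<le> n \<Longrightarrow> 1 + of_nat k \<notin> (\<int>\<^sub>\<le>\<^sub>0 :: complex set)"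
      "\<And>k. k \<le> n \<Longrightarrow> 3/2 + of_nat k \<notin> (\<int>\<^sub>\<le>\<^sub>0 :: complex set)"
      "\<And>k. k \<le> n \<Longrightarrow> lam - a + lam * of_nat k \<notin> \<int>\<^sub>\<le>\<^sub>0"
      "\<And>k. k \<le> n \<Longrightarrow> 1/2 + lam - a + (1 + lam) * of_nat k \<notin> \<int>\<^sub>\<le>\<^sub>0"
      "\<And>k. k \<le> n \<Longrightarrow> 1 + 2 * a + of_nat n + (1 + 2 * lam) * of_nat k \<notin> \<int>\<^sub>\<le>\<^sub>0"
    and denominator_nonzero:
      "(lam - a + lam * of_nat n) * (1 + 2 * a + 2 * lam * of_nat n + 2 * of_nat n)
         * pochhammer 1 n \<noteq> 0"
  shows
    "(\<Sum>k=0..n.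
        (Gamma (1 + of_nat k) * Gamma (3/2 + of_nat k)
          * Gamma (lam - a + lam * of_nat k)
          * Gamma (1/2 + lam - a + (1 + lam) * of_nat k)
          * Gamma (1 + 2 * a + of_nat n + (1 + 2 * lam) * of_nat k))
        * (rGamma (1 + of_nat n - of_nat k) * rGamma (2 + of_nat n + of_nat k)
          * rGamma (1/2 + of_nat k)
          * rGamma (1 + a + lam * of_nat k)
          * rGamma (3/2 + a + (1 + lam) * of_nat k)
          * rGamma (1 + 2 * lam - 2 * a - of_nat n + (1 + 2 * lam) * of_nat k))
        * ((-1) ^ k / fact k))
     = ((-1) ^ n * 4 powr (2 * a - lam) * pochhammer (1 + 2 * a - lam) n)
       / ((lam - a + lam * of_nat n) * (1 + 2 * a + 2 * lam * of_nat n + 2 * of_nat n)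
            * pochhammer 1 n)"
    (is "?lhs a = ?rhs a")
proof -
  \<comment> \<open>With \<open>lam\<close> fixed, the finitely many nonintegrality conditions hold
    together on a punctured neighbourhood of \<open>a\<close>.\<close>
  have "\<forall>\<^sub>F b in at a. \<forall>k\<in>{..n}. 1 + 2 * b + (1 + 2 * lam) * of_nat k \<notin> \<int>
          \<and> 1 + 2 * b - (1 + 2 * lam) * (of_nat k + 1) \<notin> \<int>"
  proof (intro eventually_ball_finite ballI eventually_conj finite_atMost)
    fix k
    show "\<forall>\<^sub>F b in at a. 1 + 2 * b + (1 + 2 * lam) * of_nat k \<notin> \<int>"
      using eventually_not_Ints_at[of 2 "1 + (1 + 2 * lam) * of_nat k" a] by (simp add: algebra_simps)
    show "\<forall>\<^sub>F b in at a. 1 + 2 * b - (1 + 2 * lam) * (of_nat k + 1) \<notin> \<int>"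
      using eventually_not_Ints_at[of 2 "1 - (1 + 2 * lam) * (of_nat k + 1)" a] by (simp add: algebra_simps)
  qed
  then have "\<forall>\<^sub>F b in at a. ?lhs b = ?rhs b"
    by eventually_elim (simp only: atLeast0AtMost, rule fox_wright_sum_nonintegral, auto)
  \<comment> \<open>The numerator Gammas are continuous at \<open>a\<close> by the pole conditions,
    and the \<open>rGamma\<close> factors are entire. Both sides thus have limits at
    \<open>a\<close> equal to their values, and these limits agree.\<close>
  moreover have "isCont ?lhs a"
    using numerator_no_poles by (intro continuous_intros) auto
  moreover have "isCont ?rhs a"
    unfolding four_powr
    by (intro isCont_divide isCont_mult isCont_o2[OF _ isCont_pochhammer] isCont_exp' isCont_diff
        isCont_add continuous_const continuous_ident denominator_nonzero)
  ultimately show ?thesis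
    unfolding isCont_def by (intro tendsto_unique[OF at_neq_bot Lim_transform_eventually])
qed

end
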